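(* Let $A$ be an $n\times n$ complex Hermitian matrix whose off-diagonal entries are all purely imaginary. Let $\lambda_1\leq \lambda_2\leq\cdots\leq\lambda_n$ be the eigenvalues of $A$ and $a_1\leq a_2\leq\cdots\leq a_n$ the diagonal entries of $A$, each listed in increasing order (with multiplicity). Then for every integer $k$ with $1\leq k\leq \lceil n/2\rceil$, $$\lambda_k\leq a_{2k-1}\quad\text{and}\quad \lambda_{n-k+1}\geq a_{n-2k+2}.$$
   Context: A complex number is purely imaginary if its real part is zero (zero counts as purely imaginary). $\lceil x\rceil$ denotes the least integer $\geq x$. *)

theory Defs
  imports
    "HOL-Computational_Algebra.Fundamental_Theorem_Algebra"
    "Jordan_Normal_Form.Char_Poly"
    "Jordan_Normal_Form.Schur_Decomposition"
begin

definition hermitian_mat :: "complex mat \<Rightarrow> bool" where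
  "hermitian_mat A \<longleftrightarrow> square_mat A \<and> mat_adjoint A = A"

definition purely_imaginary :: "complex \<Rightarrow> bool" where
  "purely_imaginary z \<longleftrightarrow> Re z = 0"

text \<open>
  Eigenvalues are counted with algebraic multiplicity. Taking real parts only changes the
  type: the eigenvalues and the diagonal entries of a Hermitian matrix are real, see
  \<open>sorted_eigenvalues_hermitian\<close> and \<open>sorted_diagonal_hermitian\<close> below.
\<close>

definition sorted_eigenvalues :: "complex mat \<Rightarrow> real list" where
  "sorted_eigenvalues A = sorted_list_of_multiset (image_mset Re (proots (char_poly A)))"

definition sorted_diagonal :: "complex mat \<Rightarrow> real list" where
  "sorted_diagonal A = sorted_list_of_multiset (image_mset Re (mset (diag_mat A)))"

text \<open>The indices of the following two functions start at 1.\<close>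

definition eigenvalue_nth :: "complex mat \<Rightarrow> nat \<Rightarrow> real" where
  "eigenvalue_nth A k = sorted_eigenvalues A ! (k - 1)"

definition diagonal_nth :: "complex mat \<Rightarrow> nat \<Rightarrow> real" where
  "diagonal_nth A k = sorted_diagonal A ! (k - 1)"

lemma hermitian_mat_index:
  assumes "hermitian_mat A" "i < dim_row A" "j < dim_row A"
  shows "cnj (A $$ (i, j)) = A $$ (j, i)"
proof -
  have sq: "dim_col A = dim_row A" and eq: "mat_adjoint A = A"
    using assms(1) by (auto simp: hermitian_mat_def)
  have "mat_adjoint A $$ (j, i) = cnj (A $$ (i, j))"
    using assms(2,3) sq by (simp add: mat_adjoint_def mat_of_rows_index)
  with eq show ?thesis by simp
qed

lemma hermitian_eigenvalue_real:
  assumes herm: "hermitian_mat A" and ev: "eigenvalue A l"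
  shows "complex_of_real (Re l) = l"
proof -
  let ?n = "dim_row A"
  have sq: "dim_col A = ?n" using herm by (simp add: hermitian_mat_def)
  obtain v where v: "dim_vec v = ?n" and v0: "v \<noteq> 0\<^sub>v ?n" and Av: "A *\<^sub>v v = l \<cdot>\<^sub>v v"
    using ev by (auto simp: eigenvalue_def eigenvector_def dest: carrier_vecD)
  define S where "S = (\<Sum>i<?n. \<Sum>j<?n. A $$ (i, j) * v $ j * cnj (v $ i))"
  define N where "N = (\<Sum>i<?n. (cmod (v $ i))\<^sup>2)"
  have row: "(\<Sum>j<?n. A $$ (i, j) * v $ j) = l * v $ i" if i: "i < ?n" for i
  proof -
    have "(A *\<^sub>v v) $ i = (\<Sum>j<?n. A $$ (i, j) * v $ j)"
      using i v sq by (simp add: scalar_prod_def lessThan_atLeast0)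
    with Av show ?thesis using i v by simp
  qed
  have "S = (\<Sum>i<?n. l * v $ i * cnj (v $ i))"
    unfolding S_def by (intro sum.cong refl) (simp add: row flip: sum_distrib_right)
  also have "\<dots> = l * of_real N"
    unfolding N_def of_real_sum sum_distrib_left
    by (intro sum.cong refl) (simp only: complex_norm_square mult.assoc)
  finally have SN: "S = l * of_real N" .
  have "cnj S = (\<Sum>i<?n. \<Sum>j<?n. A $$ (j, i) * v $ i * cnj (v $ j))"
    unfolding S_def cnj_sum
    by (intro sum.cong refl) (simp add: hermitian_mat_index[OF herm] mult_ac)
  also have "\<dots> = S" unfolding S_def by (rule sum.swap)
  finally have "cnj l * of_real N = l * of_real N" using SN by simp
  moreover have "N \<noteq> 0"
  proof
    assume "N = 0"
    hence "\<forall>i<?n. v $ i = 0"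
      unfolding N_def by (subst (asm) sum_nonneg_eq_0_iff) auto
    with v have "v = 0\<^sub>v ?n" by (intro eq_vecI) auto
    with v0 show False by simp
  qed
  ultimately have "cnj l = l" by simp
  thus ?thesis by (simp add: complex_eq_iff)
qed

lemma sorted_eigenvalues_hermitian:
  assumes "hermitian_mat A"
  shows "sorted (sorted_eigenvalues A)"
    and "length (sorted_eigenvalues A) = dim_row A"
    and "mset (map complex_of_real (sorted_eigenvalues A)) = proots (char_poly A)"
proof -
  have A: "A \<in> carrier_mat (dim_row A) (dim_row A)"
    using assms by (auto simp: hermitian_mat_def)
  note deg = degree_monic_char_poly[OF A]
  hence nz: "char_poly A \<noteq> 0" by auto
  show "sorted (sorted_eigenvalues A)" by (simp add: sorted_eigenvalues_def)
  have "length (sorted_eigenvalues A) = size (mset (sorted_eigenvalues A))" by simp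
  also have "\<dots> = dim_row A"
    unfolding sorted_eigenvalues_def mset_sorted_list_of_multiset
    using deg by (simp add: size_proots_complex)
  finally show "length (sorted_eigenvalues A) = dim_row A" .
  have "image_mset (\<lambda>x. complex_of_real (Re x)) (proots (char_poly A))
      = image_mset (\<lambda>x. x) (proots (char_poly A))"
    using nz by (intro image_mset_cong hermitian_eigenvalue_real[OF assms])
      (auto simp: eigenvalue_root_char_poly[OF A])
  thus "mset (map complex_of_real (sorted_eigenvalues A)) = proots (char_poly A)"
    by (simp add: sorted_eigenvalues_def image_mset.compositionality o_def)
qed

lemma sorted_diagonal_hermitian:
  assumes "hermitian_mat A"
  shows "sorted (sorted_diagonal A)"
    and "length (sorted_diagonal A) = dim_row A"
    and "mset (map complex_of_real (sorted_diagonal A)) = mset (diag_mat A)"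
proof -
  show "sorted (sorted_diagonal A)" by (simp add: sorted_diagonal_def)
  have "length (sorted_diagonal A) = size (mset (sorted_diagonal A))" by simp
  also have "\<dots> = dim_row A"
    unfolding sorted_diagonal_def mset_sorted_list_of_multiset by (simp add: diag_mat_def)
  finally show "length (sorted_diagonal A) = dim_row A" .
  have "complex_of_real (Re x) = x" if "x \<in> set (diag_mat A)" for x
  proof -
    from that obtain i where "i < dim_row A" "x = A $$ (i, i)" by (auto simp: diag_mat_def)
    hence "cnj x = x" using hermitian_mat_index[OF assms] by simp
    thus ?thesis by (simp add: complex_eq_iff)
  qed
  hence "image_mset (\<lambda>x. complex_of_real (Re x)) (mset (diag_mat A))
      = image_mset (\<lambda>x. x) (mset (diag_mat A))"
    by (intro image_mset_cong) auto
  thus "mset (map complex_of_real (sorted_diagonal A)) = mset (diag_mat A)"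
    by (simp add: sorted_diagonal_def image_mset.compositionality o_def)
qed

end

theory Submission
  imports Defs "Jordan_Normal_Form.Jordan_Normal_Form_Existence"
begin

text \<open>
  For every real \<open>a\<close>, the number \<open>m\<close> of diagonal entries \<open>\<le> a\<close> is at most twice the number \<open>p\<close> of
  eigenvalues \<open>\<le> a\<close>. Otherwise consider the vectors \<open>x\<close> that vanish at the \<open>n - m\<close> coordinates whose
  diagonal entry exceeds \<open>a\<close> and for which both \<open>x\<close> and its complex conjugate lie in the span of the
  eigenspaces of eigenvalues \<open>> a\<close>. These are \<open>n - m + 2p < n\<close> linear conditions, so some \<open>x \<noteq> 0\<close>
  satisfies them. The Hermitian form of \<open>A\<close> exceeds \<open>a |x|\<^sup>2\<close> at \<open>x\<close> and at its conjugate, but as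
  \<open>A\<close> plus its entrywise conjugate is twice the diagonal of \<open>A\<close>, the sum of the two values is at most
  \<open>2 a |x|\<^sup>2\<close>. Applied to \<open>-A\<close>, the same count holds for entries and eigenvalues \<open>\<ge> a\<close>, and
  both inequalities follow by comparing positions in the sorted lists.
\<close>

section \<open>Homogeneous systems and Hermitian forms\<close>

text \<open>The functionals become rows of a square matrix with a zero last row; its determinant
  vanishes, so it has a non-zero kernel vector.\<close>

lemma underdetermined_system_nontrivial_solution:
  fixes F :: "(nat \<Rightarrow> complex) set"
  assumes "finite F" and "card F < n"
  shows "\<exists>x. (\<exists>j<n. x j \<noteq> 0) \<and> (\<forall>f\<in>F. (\<Sum>j<n. f j * x j) = 0)"
proof -
  obtain h where h: "bij_betw h {0..<card F} F"
    using ex_bij_betw_nat_finite[OF assms(1)] by blast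
  define c where "c i = vec n (h i)" for i
  \<comment> \<open>As \<open>card F < n\<close>, the zero row \<open>n - 1\<close> overwrites no
    member of \<open>F\<close>. Rows from \<open>card F\<close> to \<open>n - 2\<close> hold
    arbitrary values of \<open>h\<close> and merely add equations.\<close>
  define M where "M = mat\<^sub>r n n (\<lambda>i. if i = n - 1 then 0\<^sub>v n else c i)"
  have M: "M \<in> carrier_mat n n" by (simp add: M_def)
  have "det M = 0"
    unfolding M_def using assms(2) by (intro det_row_0) (auto simp: c_def)
  then obtain v where v: "v \<in> carrier_vec n" "v \<noteq> 0\<^sub>v n" "M *\<^sub>v v = 0\<^sub>v n"
    using det_0_iff_vec_prod_zero[OF M] by blast
  have "\<exists>j<n. v $ j \<noteq> 0"
    using v(1,2) by (metis carrier_vecD eq_vecI index_zero_vec)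
  moreover have "(\<Sum>j<n. f j * v $ j) = 0" if "f \<in> F" for f
  proof -
    obtain i where i: "i < card F" "f = h i"
      using bij_betw_imp_surj_on[OF h] \<open>f \<in> F\<close> by force
    have "(M *\<^sub>v v) $ i = (\<Sum>j<n. f j * v $ j)"
      using i v(1) assms(2) by (auto simp: M_def c_def scalar_prod_def lessThan_atLeast0 intro!: sum.cong)
    thus ?thesis using v(3) i assms(2) by simp
  qed
  ultimately show ?thesis by (intro exI[of _ "\<lambda>j. v $ j"]) auto
qed

text \<open>Self-adjointness of \<open>A\<close>. With basis vectors for \<open>u\<close> and
  \<open>v\<close> it rules out Jordan chains and gives orthogonality of eigenvectors for distinct
  eigenvalues.\<close>

lemma hermitian_form_swap:
  fixes A :: "nat \<Rightarrow> nat \<Rightarrow> complex"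
  assumes "\<And>i j. i < n \<Longrightarrow> j < n \<Longrightarrow> cnj (A i j) = A j i"
  shows "(\<Sum>i<n. (\<Sum>j<n. A i j * u j) * cnj (v i)) = (\<Sum>i<n. u i * cnj (\<Sum>j<n. A i j * v j))"
proof -
  have "(\<Sum>i<n. u i * cnj (\<Sum>j<n. A i j * v j)) = (\<Sum>i<n. \<Sum>j<n. A j i * u i * cnj (v j))"
    by (simp add: sum_distrib_left assms mult_ac)
  also have "\<dots> = (\<Sum>j<n. \<Sum>i<n. A j i * u i * cnj (v j))"
    by (rule sum.swap)
  finally show ?thesis by (simp add: sum_distrib_right)
qed

lemma sum_mult_cnj_self:
  "(\<Sum>i<n. u i * cnj (u i)) = complex_of_real (\<Sum>i<(n::nat). (cmod (u i))\<^sup>2)"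
  by (simp add: complex_norm_square flip: of_real_power)

section \<open>Diagonalization of Hermitian matrices\<close>

text \<open>Such an entry lies inside a single Jordan block, where the diagonal is constant and only
  the superdiagonal is occupied above it. The induction removes the leading block.\<close>

lemma jordan_matrix_off_diagonal:
  assumes "i < j" "j < sum_list (map fst n_as)" "jordan_matrix n_as $$ (i, j) \<noteq> 0"
  shows "j = Suc i \<and> jordan_matrix n_as $$ (i, i) = jordan_matrix n_as $$ (j, j)"
  using assms
proof (induction n_as arbitrary: i j)
  case (Cons na n_as)
  obtain m a where na: "na = (m, a)" by force
  let ?N = "sum_list (map fst n_as)"
  have J: "jordan_matrix (na # n_as) =
      four_block_mat (jordan_block m a) (0\<^sub>m m ?N) (0\<^sub>m ?N m) (jordan_matrix n_as)"
    using jordan_matrix_dim[of n_as] by (simp add: jordan_matrix_def na Let_def)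
  have idx: "jordan_matrix (na # n_as) $$ (p, q) =
      (if p < m then if q < m then jordan_block m a $$ (p, q) else 0
       else if q < m then 0 else jordan_matrix n_as $$ (p - m, q - m))"
    if "p < m + ?N" "q < m + ?N" for p q
    unfolding J using that by auto
  show ?case
  proof (cases "j < m")
    case True
    thus ?thesis
      using Cons.prems idx[of i j] idx[of i i] idx[of j j] by (auto split: if_splits)
  next
    case False
    hence "m \<le> i" using Cons.prems idx[of i j] by (auto simp: na split: if_splits)
    thus ?thesis
      using Cons.prems False Cons.IH[of "i - m" "j - m"] idx[of i j] idx[of i i] idx[of j j]
      by (auto simp: na less_diff_conv2 diff_less_mono Suc_diff_le[symmetric])
  qed
qed simp

text \<open>The Jordan form of a Hermitian matrix turns out to be diagonal, so the columns of the
  transformation matrix \<open>P\<close> are already eigenvectors.\<close>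

lemma hermitian_mat_diagonalizable:
  assumes A: "A \<in> carrier_mat n n" and herm: "hermitian_mat A"
  obtains P Q :: "nat \<Rightarrow> nat \<Rightarrow> complex" and l :: "nat \<Rightarrow> real" where
    "\<forall>i<n. \<forall>j<n. (\<Sum>k<n. A $$ (i, k) * P k j) = of_real (l j) * P i j"
    "\<forall>i<n. \<forall>j<n. (\<Sum>k<n. P i k * Q k j) = (if i = j then 1 else 0)"
    "\<forall>i<n. \<forall>j<n. (\<Sum>k<n. Q i k * P k j) = (if i = j then 1 else 0)"
    "mset (sorted_eigenvalues A) = image_mset l (mset_set {..<n})"
proof -
  obtain as where as: "char_poly A = (\<Prod>a\<leftarrow>as. [:- a, 1:])"
    using char_poly_factorized[OF A] by blast
  obtain n_as where jnf: "jordan_nf A n_as"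
    using jordan_nf_exists[OF A as] by blast
  define J where "J = jordan_matrix n_as"
  have sim: "similar_mat A J" using jnf by (simp add: jordan_nf_def J_def)
  then obtain P Q where wit: "similar_mat_wit A J P Q" by (auto simp: similar_mat_def)
  note w = similar_mat_witD2[OF A wit]
  have J: "J \<in> carrier_mat n n" and P: "P \<in> carrier_mat n n" and Q: "Q \<in> carrier_mat n n"
    using w by auto
  have N: "sum_list (map fst n_as) = n" using J by (auto simp: J_def)
  have low: "J $$ (i, j) = 0" if "i < n" "j < i" for i j
    using jordan_matrix_upper_triangular[of i n_as j] that by (simp add: J_def N)
  have AP: "A * P = P * J"
    using w by (metis assoc_mult_mat mult_carrier_mat right_mult_one_mat)
  have sum_idx: "(\<Sum>k<n. X $$ (i, k) * Y $$ (k, j)) = (X * Y) $$ (i, j)"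
    if "X \<in> carrier_mat n n" "Y \<in> carrier_mat n n" "i < n" "j < n" for X Y :: "complex mat" and i j
    using that by (auto simp: scalar_prod_def lessThan_atLeast0)
  have eigJ: "(\<Sum>k<n. A $$ (i, k) * P $$ (k, j)) = (\<Sum>k<n. P $$ (i, k) * J $$ (k, j))"
    if "i < n" "j < n" for i j
    by (simp add: sum_idx A P J that AP)
  have colP: "\<exists>i<n. P $$ (i, j) \<noteq> 0" if "j < n" for j
  proof (rule ccontr)
    assume "\<not> ?thesis"
    hence "(\<Sum>k<n. Q $$ (j, k) * P $$ (k, j)) = 0" by simp
    thus False using w(2) that by (simp add: sum_idx P Q)
  qed
  have normP: "(\<Sum>i<n. P $$ (i, j) * cnj (P $$ (i, j))) \<noteq> 0" if "j < n" for j
  proof -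
    have "(\<Sum>i<n. (cmod (P $$ (i, j)))\<^sup>2) \<noteq> 0"
      using colP[OF that] by (subst sum_nonneg_eq_0_iff) auto
    thus ?thesis by (simp only: sum_mult_cnj_self of_real_eq_0_iff not_False_eq_True)
  qed
  have herm': "cnj (A $$ (i, j)) = A $$ (j, i)" if "i < n" "j < n" for i j
    using hermitian_mat_index[OF herm] that A by auto
  have cpJ: "char_poly A = (\<Prod>a\<leftarrow>diag_mat J. [:- a, 1:])"
    using char_poly_similar[OF sim] char_poly_upper_triangular[OF J] low J by auto
  have proots: "proots (char_poly A) = mset (diag_mat J)"
  proof -
    have "proots (\<Prod>a\<leftarrow>as. [:- a, 1:]) = mset as" for as :: "complex list"
    proof (induction as)
      case (Cons a as)
      have "proots ([:- a, 1:] * (\<Prod>a\<leftarrow>as. [:- a, 1:])) =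
          proots [:- a, 1:] + proots (\<Prod>a\<leftarrow>as. [:- a, 1:])"
        by (rule proots_mult) (auto simp: prod_list_zero_iff)
      thus ?case by (simp only: Cons.IH list.map prod_list.Cons) simp
    qed simp
    thus ?thesis by (simp add: cpJ)
  qed
  have real: "complex_of_real (Re (J $$ (j, j))) = J $$ (j, j)" if "j < n" for j
  proof (rule hermitian_eigenvalue_real[OF herm])
    have "char_poly A \<noteq> 0" using degree_monic_char_poly[OF A] by auto
    moreover have "J $$ (j, j) \<in># proots (char_poly A)"
      unfolding proots using that J by (auto simp: diag_mat_def)
    ultimately show "eigenvalue A (J $$ (j, j))"
      by (simp add: eigenvalue_root_char_poly[OF A])
  qed
  \<comment> \<open>In the first column with an off-diagonal entry \<open>c\<close> the basis satisfies \<open>A p\<^sub>j = \<mu> p\<^sub>j + c p\<^sub>i\<close> and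
    \<open>A p\<^sub>i = \<mu> p\<^sub>i\<close>; pairing \<open>A p\<^sub>j\<close> with \<open>p\<^sub>i\<close> gives \<open>c |p\<^sub>i|\<^sup>2 = 0\<close>.\<close>
  have diag: "J $$ (i, j) = 0" if "i < j" "j < n" for i j
    using that
  proof (induction j arbitrary: i rule: less_induct)
    case (less j)
    show ?case
    proof (rule ccontr)
      assume nz: "J $$ (i, j) \<noteq> 0"
      have off: "J $$ (k, j) = 0" if "k \<noteq> i" "k \<noteq> j" "k < n" for k
      proof (cases "k < j")
        case True
        thus ?thesis
          using jordan_matrix_off_diagonal[of k j n_as] jordan_matrix_off_diagonal[of i j n_as]
            nz less.prems that unfolding J_def N by auto
      qed (use low less.prems that in auto)
      have eq: "J $$ (i, i) = J $$ (j, j)"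
        using jordan_matrix_off_diagonal[of i j n_as] nz less.prems by (simp add: J_def N)
      \<comment> \<open>Column \<open>i\<close> precedes column \<open>j\<close>, so the induction
        hypothesis makes it diagonal and \<open>p_i\<close> is a true eigenvector.\<close>
      have coli: "J $$ (k, i) = 0" if "k \<noteq> i" "k < n" for k
        using less.IH[of i k] low[of k i] less.prems that by (cases "k < i") auto
      have Ai: "(\<Sum>k<n. A $$ (r, k) * P $$ (k, i)) = J $$ (j, j) * P $$ (r, i)" if "r < n" for r
      proof -
        have "(\<Sum>k<n. P $$ (r, k) * J $$ (k, i)) = (\<Sum>k\<in>{i}. P $$ (r, k) * J $$ (k, i))"
          using less.prems by (intro sum.mono_neutral_right) (auto simp: coli)
        thus ?thesis using eigJ[of r i] less.prems that eq by simp
      qed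
      have Aj: "(\<Sum>k<n. A $$ (r, k) * P $$ (k, j)) = J $$ (j, j) * P $$ (r, j) + J $$ (i, j) * P $$ (r, i)"
        if "r < n" for r
      proof -
        have "(\<Sum>k<n. P $$ (r, k) * J $$ (k, j)) = (\<Sum>k\<in>{i, j}. P $$ (r, k) * J $$ (k, j))"
          using less.prems by (intro sum.mono_neutral_right) (auto simp: off)
        thus ?thesis using eigJ[of r j] less.prems that by simp
      qed
      \<comment> \<open>Reality of the eigenvalue lets the two multiples of
        \<open><p_j, p_i>\<close> cancel below.\<close>
      have cnjl: "cnj (J $$ (j, j)) = J $$ (j, j)"
        using real[of j] less.prems by (metis complex_cnj_complex_of_real)
      have "(\<Sum>r<n. (J $$ (j, j) * P $$ (r, j) + J $$ (i, j) * P $$ (r, i)) * cnj (P $$ (r, i)))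
          = (\<Sum>r<n. P $$ (r, j) * cnj (J $$ (j, j) * P $$ (r, i)))"
        using hermitian_form_swap[where A = "\<lambda>i j. A $$ (i, j)" and n = n
            and u = "\<lambda>r. P $$ (r, j)" and v = "\<lambda>r. P $$ (r, i)"]
        by (simp add: Ai Aj herm')
      hence "J $$ (i, j) * (\<Sum>r<n. P $$ (r, i) * cnj (P $$ (r, i))) = 0"
        by (simp add: cnjl ring_distribs sum.distrib sum_distrib_left mult_ac)
      thus False using nz normP[of i] less.prems by simp
    qed
  qed
  have off: "J $$ (k, j) = 0" if "k < n" "j < n" "k \<noteq> j" for k j
    using diag low that by (cases "k < j") auto
  show thesis
  proof (rule that[of "\<lambda>i j. P $$ (i, j)" "\<lambda>j. Re (J $$ (j, j))" "\<lambda>i j. Q $$ (i, j)"]; (intro allI impI)?)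
    fix i j assume ij: "i < n" "j < n"
    have "(\<Sum>k<n. P $$ (i, k) * J $$ (k, j)) = (\<Sum>k\<in>{j}. P $$ (i, k) * J $$ (k, j))"
      using ij by (intro sum.mono_neutral_right) (auto simp: off)
    thus "(\<Sum>k<n. A $$ (i, k) * P $$ (k, j)) = of_real (Re (J $$ (j, j))) * P $$ (i, j)"
      using eigJ[OF ij] ij by (simp add: real)
    show "(\<Sum>k<n. P $$ (i, k) * Q $$ (k, j)) = (if i = j then 1 else 0)"
      using w ij by (simp add: sum_idx)
    show "(\<Sum>k<n. Q $$ (i, k) * P $$ (k, j)) = (if i = j then 1 else 0)"
      using w ij by (simp add: sum_idx)
  next
    have "mset (diag_mat J) = image_mset (\<lambda>j. J $$ (j, j)) (mset_set {..<n})"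
      using J by (simp add: diag_mat_def lessThan_atLeast0)
    thus "mset (sorted_eigenvalues A) = image_mset (\<lambda>j. Re (J $$ (j, j))) (mset_set {..<n})"
      by (simp add: sorted_eigenvalues_def proots image_mset.compositionality o_def)
  qed
qed

section \<open>The Hermitian form on sums of eigenspaces\<close>

text \<open>Used in both directions: to expand the form in the Gram matrix of the columns of
  \<open>P\<close>, and to fold the rescaled expansion back into a squared norm.\<close>

lemma gram_sum:
  fixes P :: "nat \<Rightarrow> nat \<Rightarrow> complex"
  shows "(\<Sum>r<n. (\<Sum>j<n. P r j * u j) * cnj (\<Sum>i<n. P r i * v i)) =
    (\<Sum>j<n. \<Sum>i<n. u j * cnj (v i) * (\<Sum>r<n. P r j * cnj (P r i)))"
proof -
  have "(\<Sum>r<n. (\<Sum>j<n. P r j * u j) * cnj (\<Sum>i<n. P r i * v i)) =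
      (\<Sum>r<n. \<Sum>j<n. \<Sum>i<n. u j * cnj (v i) * (P r j * cnj (P r i)))"
    by (simp add: sum_product mult_ac)
  also have "\<dots> = (\<Sum>j<n. \<Sum>r<n. \<Sum>i<n. u j * cnj (v i) * (P r j * cnj (P r i)))"
    by (rule sum.swap)
  also have "\<dots> = (\<Sum>j<n. \<Sum>i<n. \<Sum>r<n. u j * cnj (v i) * (P r j * cnj (P r i)))"
    by (intro sum.cong refl sum.swap)
  finally show ?thesis by (simp add: sum_distrib_left)
qed

text \<open>
  The eigenbasis, the columns of \<open>P\<close>, need not be orthogonal: its Gram matrix only couples equal
  eigenvalues, so it commutes with the diagonal matrix of \<open>s j = sqrt (l j - a)\<close>, and the form of
  \<open>A - a\<close> at \<open>x = P y\<close> equals \<open>|P (s y)|\<^sup>2\<close>.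
\<close>

lemma hermitian_form_gt_on_eigenspaces:
  fixes A P :: "nat \<Rightarrow> nat \<Rightarrow> complex" and l :: "nat \<Rightarrow> real"
  assumes herm: "\<And>i j. i < n \<Longrightarrow> j < n \<Longrightarrow> cnj (A i j) = A j i"
    and eig: "\<And>i j. i < n \<Longrightarrow> j < n \<Longrightarrow> (\<Sum>k<n. A i k * P k j) = of_real (l j) * P i j"
    and inj: "\<And>z. (\<And>i. i < n \<Longrightarrow> (\<Sum>j<n. P i j * z j) = 0) \<Longrightarrow> (\<And>j. j < n \<Longrightarrow> z j = 0)"
    and x: "\<And>i. i < n \<Longrightarrow> x i = (\<Sum>j<n. P i j * y j)"
    and y: "\<And>j. j < n \<Longrightarrow> y j \<noteq> 0 \<Longrightarrow> a < l j"
    and nz: "\<exists>i<n. x i \<noteq> 0"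
  shows "a * (\<Sum>i<n. (cmod (x i))\<^sup>2) < Re (\<Sum>i<n. (\<Sum>j<n. A i j * x j) * cnj (x i))"
proof -
  \<comment> \<open>Where \<open>l j < a\<close> this is the root of a negative number, which is
    harmless because \<open>y j = 0\<close> there.\<close>
  define s where "s j = sqrt (l j - a)" for j
  define z where "z i = (\<Sum>j<n. P i j * (of_real (s j) * y j))" for i
  have gram: "(\<Sum>r<n. P r j * cnj (P r i)) = 0" if "i < n" "j < n" "l i \<noteq> l j" for i j
  proof -
    have "(\<Sum>r<n. (of_real (l j) * P r j) * cnj (P r i)) = (\<Sum>r<n. P r j * cnj (of_real (l i) * P r i))"
      using hermitian_form_swap[where A = A and n = n and u = "\<lambda>r. P r j" and v = "\<lambda>r. P r i"]
      by (simp add: herm eig that)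
    hence "of_real (l j) * (\<Sum>r<n. P r j * cnj (P r i)) = of_real (l i) * (\<Sum>r<n. P r j * cnj (P r i))"
      by (simp add: sum_distrib_left mult_ac)
    thus ?thesis using that(3) by simp
  qed
  have Ax: "(\<Sum>j<n. A r j * x j) - of_real a * x r = (\<Sum>j<n. P r j * (of_real (l j - a) * y j))"
    if r: "r < n" for r
  proof -
    have "(\<Sum>k<n. A r k * x k) = (\<Sum>k<n. \<Sum>j<n. A r k * P k j * y j)"
      by (simp add: x sum_distrib_left mult_ac)
    also have "\<dots> = (\<Sum>j<n. \<Sum>k<n. A r k * P k j * y j)"
      by (rule sum.swap)
    also have "\<dots> = (\<Sum>j<n. of_real (l j) * P r j * y j)"
      using r by (simp add: eig flip: sum_distrib_right)
    finally show ?thesis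
      using r by (simp add: x sum_distrib_left sum_subtractf ring_distribs mult_ac)
  qed
  have "(\<Sum>r<n. (\<Sum>j<n. A r j * x j) * cnj (x r)) - of_real a * (\<Sum>r<n. x r * cnj (x r))
      = (\<Sum>r<n. ((\<Sum>j<n. A r j * x j) - of_real a * x r) * cnj (x r))"
    by (simp add: sum_distrib_left sum_subtractf ring_distribs mult_ac)
  also have "\<dots> = (\<Sum>r<n. (\<Sum>j<n. P r j * (of_real (l j - a) * y j)) * cnj (\<Sum>i<n. P r i * y i))"
    by (intro sum.cong refl arg_cong2[where f = "(*)"] arg_cong[where f = cnj]) (auto simp: Ax x[symmetric])
  also have "\<dots> = (\<Sum>j<n. \<Sum>i<n. of_real (l j - a) * y j * cnj (y i) * (\<Sum>r<n. P r j * cnj (P r i)))"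
    by (rule gram_sum)
  also have "\<dots> = (\<Sum>j<n. \<Sum>i<n. of_real (s j) * y j * cnj (of_real (s i) * y i)
      * (\<Sum>r<n. P r j * cnj (P r i)))"
  proof (intro sum.cong refl)
    fix j i assume ij: "j \<in> {..<n}" "i \<in> {..<n}"
    show "of_real (l j - a) * y j * cnj (y i) * (\<Sum>r<n. P r j * cnj (P r i)) =
      of_real (s j) * y j * cnj (of_real (s i) * y i) * (\<Sum>r<n. P r j * cnj (P r i))"
    \<comment> \<open>If \<open>l i = l j\<close> and \<open>y j \<noteq> 0\<close>, then
      \<open>l j > a\<close>, so \<open>s j\<close> squares to \<open>l j - a\<close> and equals
      \<open>s i\<close>. Otherwise the Gram entry or \<open>y j\<close> vanishes, and with it both
      sides.\<close>
    proof (cases "l i = l j \<and> y j \<noteq> 0")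
      case True
      hence "s i = s j" "s j * s j = l j - a" using y[of j] ij by (auto simp: s_def)
      hence "complex_of_real (l j - a) = of_real (s j) * of_real (s i)"
        by (simp flip: of_real_mult)
      thus ?thesis by simp
    qed (use gram[of i j] ij in auto)
  qed
  also have "\<dots> = (\<Sum>r<n. z r * cnj (z r))"
    unfolding z_def by (rule gram_sum[symmetric])
  finally have eq: "(\<Sum>r<n. (\<Sum>j<n. A r j * x j) * cnj (x r))
      = of_real (a * (\<Sum>r<n. (cmod (x r))\<^sup>2) + (\<Sum>r<n. (cmod (z r))\<^sup>2))"
    unfolding sum_mult_cnj_self of_real_add of_real_mult by (simp only: diff_eq_eq add.commute)
  have "Re (\<Sum>r<n. (\<Sum>j<n. A r j * x j) * cnj (x r))
      = a * (\<Sum>r<n. (cmod (x r))\<^sup>2) + (\<Sum>r<n. (cmod (z r))\<^sup>2)"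
    unfolding eq by (rule Re_complex_of_real)
  \<comment> \<open>If \<open>z = 0\<close>, injectivity of \<open>P\<close> gives
    \<open>s j * y j = 0\<close> for all \<open>j\<close>. Since \<open>s j \<noteq> 0\<close>
    wherever \<open>y j \<noteq> 0\<close>, both \<open>y\<close> and \<open>x\<close> would
    vanish.\<close>
  moreover have "(\<Sum>r<n. (cmod (z r))\<^sup>2) \<noteq> 0"
  proof
    assume "(\<Sum>r<n. (cmod (z r))\<^sup>2) = 0"
    hence z0: "z r = 0" if "r < n" for r
      using that by (subst (asm) sum_nonneg_eq_0_iff) auto
    have "y j = 0" if j: "j < n" for j
    proof -
      have "of_real (s j) * y j = 0"
        by (rule inj[of "\<lambda>j. of_real (s j) * y j"]) (use z0 j in \<open>auto simp: z_def\<close>)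
      thus ?thesis using y[OF j] by (auto simp: s_def)
    qed
    thus False using nz by (auto simp: x)
  qed
  moreover have "(\<Sum>r<n. (cmod (z r))\<^sup>2) \<ge> 0" by (intro sum_nonneg) auto
  ultimately show ?thesis by linarith
qed

section \<open>Counting diagonal entries against eigenvalues\<close>

lemma card_diagonal_le_twice_card_eigenvalues:
  fixes A P Q :: "nat \<Rightarrow> nat \<Rightarrow> complex" and l :: "nat \<Rightarrow> real"
  assumes herm: "\<And>i j. i < n \<Longrightarrow> j < n \<Longrightarrow> cnj (A i j) = A j i"
    and imag: "\<And>i j. i < n \<Longrightarrow> j < n \<Longrightarrow> i \<noteq> j \<Longrightarrow> Re (A i j) = 0"
    and eig: "\<And>i j. i < n \<Longrightarrow> j < n \<Longrightarrow> (\<Sum>k<n. A i k * P k j) = of_real (l j) * P i j"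
    and PQ: "\<And>i j. i < n \<Longrightarrow> j < n \<Longrightarrow> (\<Sum>k<n. P i k * Q k j) = (if i = j then 1 else 0)"
    and QP: "\<And>i j. i < n \<Longrightarrow> j < n \<Longrightarrow> (\<Sum>k<n. Q i k * P k j) = (if i = j then 1 else 0)"
  shows "card {i. i < n \<and> Re (A i i) \<le> a} \<le> 2 * card {j. j < n \<and> l j \<le> a}"
proof (rule ccontr)
  assume contr: "\<not> ?thesis"
  let ?D = "{i. i < n \<and> Re (A i i) \<le> a}" and ?D' = "{i. i < n \<and> a < Re (A i i)}"
    and ?L = "{j. j < n \<and> l j \<le> a}"
  have inverse: "(\<Sum>j<n. X i j * (\<Sum>k<n. Y j k * z k)) = z i"
    if i: "i < n" and XY: "\<And>j. j < n \<Longrightarrow> (\<Sum>k<n. X i k * Y k j) = (if i = j then 1 else 0)"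
    for X Y :: "nat \<Rightarrow> nat \<Rightarrow> complex" and z i
  proof -
    have "(\<Sum>j<n. X i j * (\<Sum>k<n. Y j k * z k)) = (\<Sum>j<n. \<Sum>k<n. X i j * Y j k * z k)"
      by (simp add: sum_distrib_left mult_ac)
    also have "\<dots> = (\<Sum>k<n. \<Sum>j<n. X i j * Y j k * z k)"
      by (rule sum.swap)
    also have "\<dots> = (\<Sum>k<n. if i = k then z k else 0)"
      by (intro sum.cong refl) (simp add: XY flip: sum_distrib_right)
    finally show ?thesis using i by simp
  qed
  \<comment> \<open>The three families force to zero the coordinates of \<open>x\<close> with
    diagonal entry above \<open>a\<close>, its eigenbasis coordinates with
    \<open>l j \<le> a\<close>, and, after conjugation, the same eigenbasis coordinates of the
    conjugate of \<open>x\<close>.\<close>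
  define F where "F = (\<lambda>i j. if j = i then 1 else 0) ` ?D' \<union> (Q ` ?L \<union> (\<lambda>j k. cnj (Q j k)) ` ?L)"
  have "card F \<le> card ?D' + (card ?L + card ?L)"
    unfolding F_def
    by (intro card_Un_le[THEN order_trans] add_mono card_image_le) auto
  moreover have "card ?D + card ?D' = n"
  proof -
    have "card (?D \<union> ?D') = card ?D + card ?D'" by (rule card_Un_disjoint) auto
    moreover have "?D \<union> ?D' = {..<n}" by auto
    ultimately show ?thesis by simp
  qed
  ultimately have "card F < n" using contr by linarith
  moreover have "finite F" by (auto simp: F_def)
  ultimately obtain x where nz: "\<exists>j<n. x j \<noteq> 0" and sol: "\<And>f. f \<in> F \<Longrightarrow> (\<Sum>j<n. f j * x j) = 0"
    using underdetermined_system_nontrivial_solution by blast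
  have supp: "x i = 0" if "i < n" "a < Re (A i i)" for i
    using sol[of "\<lambda>j. if j = i then 1 else 0"] that
    by (auto simp: F_def if_distrib[of "\<lambda>t. t * _"] cong: if_cong)
  have Qx: "(\<Sum>k<n. Q j k * x k) = 0" if "j < n" "l j \<le> a" for j
    using sol[of "Q j"] that by (auto simp: F_def)
  have Qcx: "(\<Sum>k<n. Q j k * cnj (x k)) = 0" if "j < n" "l j \<le> a" for j
  proof -
    have "cnj (\<Sum>k<n. cnj (Q j k) * x k) = 0"
      using sol[of "\<lambda>k. cnj (Q j k)"] that by (auto simp: F_def)
    thus ?thesis by simp
  qed
  \<comment> \<open>The eigenbasis coordinates of \<open>u\<close> are \<open>Q u\<close>; both
    \<open>x\<close> and its conjugate will be taken for \<open>u\<close>.\<close>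
  have gt: "a * (\<Sum>i<n. (cmod (u i))\<^sup>2) < Re (\<Sum>i<n. (\<Sum>j<n. A i j * u j) * cnj (u i))"
    if "\<exists>j<n. u j \<noteq> 0" "\<And>j. j < n \<Longrightarrow> l j \<le> a \<Longrightarrow> (\<Sum>k<n. Q j k * u k) = 0" for u
  proof (rule hermitian_form_gt_on_eigenspaces[where P = P and l = l and y = "\<lambda>j. \<Sum>k<n. Q j k * u k"])
    show "z j = 0" if "\<And>i. i < n \<Longrightarrow> (\<Sum>j<n. P i j * z j) = 0" "j < n" for z j
      using inverse[of j Q P z] QP that by simp
    show "u i = (\<Sum>j<n. P i j * (\<Sum>k<n. Q j k * u k))" if "i < n" for i
      using inverse[of i P Q u] PQ that by simp
  qed (use that herm eig in \<open>auto simp: not_le[symmetric]\<close>)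
  have "2 * (a * (\<Sum>i<n. (cmod (x i))\<^sup>2)) <
      Re (\<Sum>i<n. (\<Sum>j<n. A i j * x j) * cnj (x i)) + Re (\<Sum>i<n. (\<Sum>j<n. A i j * cnj (x j)) * x i)"
    using gt[of x] gt[of "\<lambda>i. cnj (x i)"] nz Qx Qcx by simp
  also have "\<dots> = (\<Sum>i<n. \<Sum>j<n. Re (A i j * (x j * cnj (x i) + cnj (x j) * x i)))"
    by (simp only: sum_distrib_right sum.distrib ring_distribs Re_sum plus_complex.sel mult.assoc)
  also have "\<dots> = (\<Sum>i<n. \<Sum>j<n. if j = i then 2 * (Re (A i i) * (cmod (x i))\<^sup>2) else 0)"
  proof (intro sum.cong refl)
    fix i j assume ij: "i \<in> {..<n}" "j \<in> {..<n}"
    \<comment> \<open>The bracket is real, so only \<open>Re (A i j)\<close> counts, and this is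
      zero off the diagonal.\<close>
    have "x j * cnj (x i) + cnj (x j) * x i = of_real (2 * Re (x j * cnj (x i)))"
      by (simp add: complex_eq_iff)
    hence "Re (A i j * (x j * cnj (x i) + cnj (x j) * x i)) = Re (A i j) * (2 * Re (x j * cnj (x i)))"
      by (simp only: Re_complex_of_real Im_complex_of_real times_complex.sel mult_zero_right diff_zero)
    thus "Re (A i j * (x j * cnj (x i) + cnj (x j) * x i)) =
        (if j = i then 2 * (Re (A i i) * (cmod (x i))\<^sup>2) else 0)"
      using ij imag[of i j] by (auto simp: cmod_power2 simp flip: power2_eq_square)
  qed
  also have "\<dots> = (\<Sum>i<n. 2 * (Re (A i i) * (cmod (x i))\<^sup>2))"
    by simp
  also have "\<dots> \<le> (\<Sum>i<n. 2 * (a * (cmod (x i))\<^sup>2))"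
  proof (intro sum_mono)
    fix i assume "i \<in> {..<n}"
    thus "2 * (Re (A i i) * (cmod (x i))\<^sup>2) \<le> 2 * (a * (cmod (x i))\<^sup>2)"
      using supp[of i] by (cases "a < Re (A i i)") (auto intro: mult_right_mono)
  qed
  finally show False by (simp add: sum_distrib_left)
qed

section \<open>From counts to positions in sorted lists\<close>

text \<open>The entries \<open>\<le> a\<close> of a sorted list form an initial segment, and
  position \<open>k\<close>, counted from 0, lies in it exactly when its length exceeds
  \<open>k\<close>.\<close>

lemma sorted_nth_le_iff:
  fixes xs :: "real list"
  assumes "sorted xs" "k < length xs"
  shows "xs ! k \<le> a \<longleftrightarrow> k < size (filter_mset (\<lambda>x. x \<le> a) (mset xs))"
  using assms
proof (induction xs arbitrary: k)
  case (Cons x xs)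
  show ?case
  proof (cases "x \<le> a")
    case True
    thus ?thesis using Cons by (cases k) auto
  next
    case False
    hence gt: "\<not> y \<le> a" if "y \<in> set (x # xs)" for y using Cons.prems(1) that by auto
    hence "filter_mset (\<lambda>x. x \<le> a) (mset (x # xs)) = {#}" by (auto simp: filter_mset_eq_conv)
    thus ?thesis using gt[OF nth_mem[OF Cons.prems(2)]] by simp
  qed
qed simp

text \<open>Negating and reversing keeps the list sorted and turns lower bounds into upper bounds,
  with \<open>k\<close> moving to \<open>length xs - 1 - k\<close>.\<close>

lemma sorted_nth_ge_iff:
  fixes xs :: "real list"
  assumes "sorted xs" "k < length xs"
  shows "a \<le> xs ! k \<longleftrightarrow> length xs - k \<le> size (filter_mset (\<lambda>x. a \<le> x) (mset xs))"
proof -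
  have s: "sorted (map uminus (rev xs))"
    using assms(1) by (simp add: sorted_wrt_map sorted_wrt_rev)
  have "mset (map uminus (rev xs)) = image_mset uminus (mset xs)" by simp
  hence c: "size (filter_mset (\<lambda>x. x \<le> - a) (mset (map uminus (rev xs))))
      = size (filter_mset (\<lambda>x. a \<le> x) (mset xs))"
    by (simp only: filter_mset_image_mset size_image_mset) simp
  have "map uminus (rev xs) ! (length xs - 1 - k) = - (xs ! k)"
    using assms(2) by (simp add: rev_nth)
  thus ?thesis
    using sorted_nth_le_iff[OF s, of "length xs - 1 - k" "- a"] assms(2) unfolding c by auto
qed

lemma size_filter_image_mset_set:
  "size (filter_mset p (image_mset f (mset_set {..<n}))) = card {i. i < (n::nat) \<and> p (f i)}"
proof -
  have "{i \<in> {..<n}. p (f i)} = {i. i < n \<and> p (f i)}" by auto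
  thus ?thesis by (simp add: filter_mset_image_mset)
qed

theorem theorem2:
  fixes A :: "complex mat" and n k :: nat
  assumes "A \<in> carrier_mat n n"
    and "hermitian_mat A"
    and "\<And>i j. i < n \<Longrightarrow> j < n \<Longrightarrow> i \<noteq> j \<Longrightarrow> purely_imaginary (A $$ (i, j))"
    and "1 \<le> k" and "int k \<le> \<lceil>real n / 2\<rceil>"
  shows "eigenvalue_nth A k \<le> diagonal_nth A (2 * k - 1) \<and>
         eigenvalue_nth A (n - k + 1) \<ge> diagonal_nth A (n + 2 - 2 * k)"
proof -
  note A = assms(1) and herm = assms(2)
  have kn: "2 * k - 1 \<le> n" using assms(4,5) by linarith
  have dim: "dim_row A = n" using A by simp
  obtain P Q :: "nat \<Rightarrow> nat \<Rightarrow> complex" and l where PQl: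
    "\<forall>i<n. \<forall>j<n. (\<Sum>k<n. A $$ (i, k) * P k j) = of_real (l j) * P i j"
    "\<forall>i<n. \<forall>j<n. (\<Sum>k<n. P i k * Q k j) = (if i = j then 1 else 0)"
    "\<forall>i<n. \<forall>j<n. (\<Sum>k<n. Q i k * P k j) = (if i = j then 1 else 0)"
    and l: "mset (sorted_eigenvalues A) = image_mset l (mset_set {..<n})"
    by (rule hermitian_mat_diagonalizable[OF A herm])
  let ?e = "sorted_eigenvalues A" and ?d = "sorted_diagonal A"
  note e = sorted_eigenvalues_hermitian(1,2)[OF herm, unfolded dim]
    and d = sorted_diagonal_hermitian(1,2)[OF herm, unfolded dim]
  have dm: "mset ?d = image_mset (\<lambda>i. Re (A $$ (i, i))) (mset_set {..<n})"
    using A by (simp add: sorted_diagonal_def diag_mat_def image_mset.compositionality o_def lessThan_atLeast0)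
  note count = size_filter_image_mset_set
  have herm': "cnj (A $$ (i, j)) = A $$ (j, i)" if "i < n" "j < n" for i j
    using hermitian_mat_index[OF herm] that dim by auto
  have imag: "Re (A $$ (i, j)) = 0" if "i < n" "j < n" "i \<noteq> j" for i j
    using assms(3) that by (simp add: purely_imaginary_def)
  have le: "size (filter_mset (\<lambda>x. x \<le> a) (mset ?d)) \<le> 2 * size (filter_mset (\<lambda>x. x \<le> a) (mset ?e))" for a
    unfolding l dm count
    by (rule card_diagonal_le_twice_card_eigenvalues[where P = P and Q = Q])
      (use herm' imag PQl in auto)
  \<comment> \<open>The matrix \<open>- A\<close> has the same eigenvectors, with eigenvalues
    \<open>- l j\<close>.\<close>
  have ge: "size (filter_mset (\<lambda>x. a \<le> x) (mset ?d)) \<le> 2 * size (filter_mset (\<lambda>x. a \<le> x) (mset ?e))" for a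
    unfolding l dm count
    using card_diagonal_le_twice_card_eigenvalues[where A = "\<lambda>i j. - A $$ (i, j)" and n = n
        and P = P and Q = Q and l = "\<lambda>j. - l j" and a = "- a"] herm' imag PQl
    by (simp add: sum_negf)
  have "?e ! (k - 1) \<le> ?d ! (2 * k - 2)" (is "_ \<le> ?a")
  proof -
    have "2 * k - 2 < size (filter_mset (\<lambda>x. x \<le> ?a) (mset ?d))"
      using sorted_nth_le_iff[OF d(1), of "2 * k - 2" ?a] kn assms(4) d(2) by simp
    \<comment> \<open>Parity closes the gap: \<open>2 * k - 1 \<le> 2 * p\<close> forces
      \<open>k \<le> p\<close>.\<close>
    hence "k - 1 < size (filter_mset (\<lambda>x. x \<le> ?a) (mset ?e))"
      using le[of ?a] by linarith
    thus ?thesis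
      using sorted_nth_le_iff[OF e(1), of "k - 1" ?a] kn assms(4) e(2) by simp
  qed
  moreover have "?e ! (n - k) \<ge> ?d ! (n + 1 - 2 * k)" (is "_ \<ge> ?b")
  proof -
    \<comment> \<open>From position \<open>n + 1 - 2 * k\<close> to the end there are again
      \<open>2 * k - 1\<close> entries; \<open>kn\<close> ensures that the subtraction is not
      truncated.\<close>
    have "n - (n + 1 - 2 * k) \<le> size (filter_mset (\<lambda>x. ?b \<le> x) (mset ?d))"
      using sorted_nth_ge_iff[OF d(1), of "n + 1 - 2 * k" ?b] kn assms(4) d(2) by simp
    hence "n - (n - k) \<le> size (filter_mset (\<lambda>x. ?b \<le> x) (mset ?e))"
      using ge[of ?b] kn assms(4) by linarith
    thus ?thesis
      using sorted_nth_ge_iff[OF e(1), of "n - k" ?b] kn assms(4) e(2) by simp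
  qed
  ultimately show ?thesis
    using assms(4) by (simp add: eigenvalue_nth_def diagonal_nth_def numeral_2_eq_2)
qed

end
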